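(* Let $n, m, t$ be positive integers such that the set $\mathcal{S}^{(n)}_{t,m}$ of vectors in $\mathbb{Z}_m^n$ of Lee weight $t$ is nonempty, and let $r := \lfloor m/2\rfloor$. Consider the following random procedure (all random choices being made independently): 1. choose a partition $\lambda = (\lambda_1,\dots,\lambda_{\ell_\lambda}) \in \mathcal{P}_r(t)$ with probability $p_\lambda := |\mathcal{V}^{(n)}_{t,\lambda}| \big/ \sum_{\tilde\lambda \in \mathcal{P}_r(t)} |\mathcal{V}^{(n)}_{t,\tilde\lambda}|$; 2. choose $(f_1,\dots,f_{\ell_\lambda})$ uniformly at random from $\{\pm 1\}^{\ell_\lambda}$; 3. choose a subset $S = \{s_1 < \dots < s_{\ell_\lambda}\}$ of $\{1,\dots,n\}$ of size $\ell_\lambda$ uniformly at random among all such subsets; 4. define $\mathbf{e} \in \mathbb{Z}_m^n$ by $e_{s_j} := f_j \lambda_j \bmod m$ for $j = 1,\dots,\ell_\lambda$ and $e_i := 0$ for $i \notin S$; 5. output the vector obtained from $\mathbf{e}$ by permuting its $n$ coordinates with a uniformly random permutation. Then the output is uniformly distributed on $\mathcal{S}^{(n)}_{t,m}$.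
   Context: $\mathbb{Z}_m$ is the ring of integers modulo $m$. The Lee weight of $a \in \mathbb{Z}_m$ is $\mathrm{wt}_L(a) := \min(a, m-a)$ (with $a$ taken in $\{0,\dots,m-1\}$), the Lee weight of a vector is the sum of the Lee weights of its entries, and $\mathcal{S}^{(n)}_{t,m} := \{\mathbf{e} \in \mathbb{Z}_m^n : \mathrm{wt}_L(\mathbf{e}) = t\}$. An integer partition of $t$ of length $\ell_\lambda$ is a tuple $\lambda = (\lambda_1,\dots,\lambda_{\ell_\lambda})$ of positive integers with $\lambda_1 \ge \dots \ge \lambda_{\ell_\lambda}$ and sum $t$; $\mathcal{P}_r(t)$ is the set of integer partitions of $t$ with all parts at most $r$. A vector $\mathbf{x} \in \mathbb{Z}_m^n$ has weight decomposition $\lambda$ if the multiset of Lee weights of its nonzero entries equals the multiset of parts of $\lambda$; $\mathcal{V}^{(n)}_{t,\lambda}$ denotes the set of all vectors in $\mathbb{Z}_m^n$ with weight decomposition $\lambda$ (it is empty if $\ell_\lambda > n$, so such $\lambda$ are chosen with probability $0$). *)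

theory Defs
  imports "HOL-Probability.Probability" "HOL-Number_Theory.Residues"
begin

text \<open>
  The ring of integers modulo \<open>m\<close> is \<open>residue_ring (int m)\<close>, with carrier \<open>{0..int m - 1}\<close>.
  Vectors over it are extensional functions on the index set \<open>{1..n}\<close>.
\<close>

definition zm_vecs :: "nat \<Rightarrow> nat \<Rightarrow> (nat \<Rightarrow> int) set" where
  "zm_vecs n m = ({1..n} \<rightarrow>\<^sub>E carrier (residue_ring (int m)))"

definition lee_wt :: "nat \<Rightarrow> int \<Rightarrow> nat" where
  "lee_wt m a = nat (min a (int m - a))"

definition lee_weight :: "nat \<Rightarrow> nat \<Rightarrow> (nat \<Rightarrow> int) \<Rightarrow> nat" where
  "lee_weight n m x = (\<Sum>i\<in>{1..n}. lee_wt m (x i))"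

definition lee_sphere :: "nat \<Rightarrow> nat \<Rightarrow> nat \<Rightarrow> (nat \<Rightarrow> int) set" where
  "lee_sphere n m t = {e \<in> zm_vecs n m. lee_weight n m e = t}"

definition partitions :: "nat \<Rightarrow> nat \<Rightarrow> nat list set" where
  "partitions r t = {l. sorted_wrt (\<ge>) l \<and> (\<forall>k\<in>set l. 0 < k \<and> k \<le> r) \<and> sum_list l = t}"

definition weight_decomp :: "nat \<Rightarrow> nat \<Rightarrow> (nat \<Rightarrow> int) \<Rightarrow> nat multiset" where
  "weight_decomp n m x = {# lee_wt m (x i). i \<in># mset_set {i\<in>{1..n}. x i \<noteq> 0} #}"

definition decomp_vecs :: "nat \<Rightarrow> nat \<Rightarrow> nat list \<Rightarrow> (nat \<Rightarrow> int) set" where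
  "decomp_vecs n m l = {x \<in> zm_vecs n m. weight_decomp n m x = mset l}"

definition partition_prob :: "nat \<Rightarrow> nat \<Rightarrow> nat \<Rightarrow> nat list \<Rightarrow> real" where
  "partition_prob n m t l =
     real (card (decomp_vecs n m l)) /
     (\<Sum>l'\<in>partitions (m div 2) t. real (card (decomp_vecs n m l')))"

text \<open>
  \<open>embed_pmf\<close> is only meaningful for nonnegative functions of total mass one;
  lemma \<open>pmf_partition_pmf\<close> below shows that this holds if the Lee sphere is nonempty.
\<close>

definition partition_pmf :: "nat \<Rightarrow> nat \<Rightarrow> nat \<Rightarrow> nat list pmf" where
  "partition_pmf n m t =
     embed_pmf (\<lambda>l. if l \<in> partitions (m div 2) t then partition_prob n m t l else 0)"

text \<open>
  The \<open>j\<close>-th smallest element of \<open>S\<close> receives the entry \<open>f\<^sub>j \<lambda>\<^sub>j mod m\<close>, where \<open>l\<close> is the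
  list of the \<open>\<lambda>\<^sub>j\<close>; all other coordinates are zero.
\<close>

definition place :: "nat \<Rightarrow> nat \<Rightarrow> nat list \<Rightarrow> int list \<Rightarrow> nat set \<Rightarrow> nat \<Rightarrow> int" where
  "place n m l f S =
     (\<lambda>i\<in>{1..n}.
        case map_of (zip (sorted_list_of_set S) (map2 (\<lambda>s k. (s * int k) mod int m) f l)) i of
          None \<Rightarrow> 0
        | Some v \<Rightarrow> v)"

text \<open>
  If \<open>length l > n\<close>, the set from which \<open>S\<close> is drawn is empty and \<open>pmf_of_set\<close> is
  unspecified, but such \<open>l\<close> have probability zero under \<open>partition_pmf\<close>.
  Composition with \<open>p\<close> preserves extensionality because \<open>p\<close> fixes every index outside \<open>{1..n}\<close>.
\<close>

definition lee_sampler :: "nat \<Rightarrow> nat \<Rightarrow> nat \<Rightarrow> (nat \<Rightarrow> int) pmf" where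
  "lee_sampler n m t = do {
     l \<leftarrow> partition_pmf n m t;
     f \<leftarrow> pmf_of_set {f. length f = length l \<and> set f \<subseteq> {1, -1}};
     S \<leftarrow> pmf_of_set {S. S \<subseteq> {1..n} \<and> card S = length l};
     p \<leftarrow> pmf_of_set {p. p permutes {1..n}};
     return_pmf (place n m l f S \<circ> p)
   }"

lemma finite_zm_vecs: "finite (zm_vecs n m)"
  unfolding zm_vecs_def by (auto intro!: finite_PiE simp: residue_ring_def)

lemma finite_partitions: "finite (partitions r t)"
proof -
  have *: "length l \<le> sum_list l" if "\<forall>k\<in>set l. 0 < k" for l :: "nat list"
    using that by (induction l) auto
  have "partitions r t \<subseteq> {l. set l \<subseteq> {..r} \<and> length l \<le> t}"
    using * by (auto simp: partitions_def)
  then show ?thesis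
    using finite_lists_length_le[of "{..r}" t] finite_subset by auto
qed

lemma lee_sphere_decomp:
  assumes "e \<in> lee_sphere n m t"
  shows "\<exists>l\<in>partitions (m div 2) t. e \<in> decomp_vecs n m l"
proof -
  define l where "l = rev (sorted_list_of_multiset (weight_decomp n m e))"
  have e: "e i \<in> {0..int m - 1}" if "i \<in> {1..n}" for i
    using assms that by (auto simp: lee_sphere_def zm_vecs_def residue_ring_def PiE_iff)
  have ml: "mset l = weight_decomp n m e"
    by (simp add: l_def)
  have "sum_list l = sum_mset (weight_decomp n m e)"
    by (metis ml sum_mset_sum_list)
  also have "\<dots> = (\<Sum>i\<in>{i\<in>{1..n}. e i \<noteq> 0}. lee_wt m (e i))"
    by (simp add: weight_decomp_def sum_unfold_sum_mset)
  also have "\<dots> = lee_weight n m e"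
    unfolding lee_weight_def by (rule sum.mono_neutral_left) (auto simp: lee_wt_def)
  finally have s: "sum_list l = t"
    using assms by (simp add: lee_sphere_def)
  have "set l = set_mset (weight_decomp n m e)"
    by (metis ml set_mset_mset)
  also have "\<dots> = (\<lambda>i. lee_wt m (e i)) ` {i\<in>{1..n}. e i \<noteq> 0}"
    by (simp add: weight_decomp_def)
  finally have "\<forall>k\<in>set l. 0 < k \<and> k \<le> m div 2"
    using e by (force simp: lee_wt_def)
  moreover have "sorted_wrt (\<ge>) l"
    by (simp add: l_def sorted_wrt_rev)
  ultimately have "l \<in> partitions (m div 2) t"
    using s by (simp add: partitions_def)
  moreover have "e \<in> decomp_vecs n m l"
    using assms ml by (simp add: decomp_vecs_def lee_sphere_def)
  ultimately show ?thesis by blast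
qed

lemma pmf_partition_pmf:
  assumes "lee_sphere n m t \<noteq> {}"
  shows "pmf (partition_pmf n m t) l =
    (if l \<in> partitions (m div 2) t then partition_prob n m t l else 0)"
proof -
  let ?P = "partitions (m div 2) t"
  let ?f = "\<lambda>l. if l \<in> ?P then partition_prob n m t l else 0"
  let ?d = "\<Sum>l'\<in>?P. real (card (decomp_vecs n m l'))"
  obtain l0 e where l0: "l0 \<in> ?P" "e \<in> decomp_vecs n m l0"
    using assms lee_sphere_decomp by blast
  have "finite (decomp_vecs n m l0)"
    using finite_zm_vecs by (simp add: decomp_vecs_def)
  then have "0 < card (decomp_vecs n m l0)"
    using l0 by (auto simp: card_gt_0_iff)
  then have d: "0 < ?d"
    using l0 by (intro sum_pos2[OF finite_partitions]) auto
  have nn: "0 \<le> ?f l" for l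
    using d by (auto simp: partition_prob_def)
  have "(\<integral>\<^sup>+ l. ennreal (?f l) \<partial>count_space UNIV) = (\<Sum>l\<in>?P. ennreal (?f l))"
    by (rule nn_integral_count_space'[OF finite_partitions]) auto
  also have "\<dots> = ennreal (\<Sum>l\<in>?P. ?f l)"
    by (rule sum_ennreal) (rule nn)
  also have "(\<Sum>l\<in>?P. ?f l) = 1"
    using d by (simp add: partition_prob_def flip: sum_divide_distrib)
  finally show ?thesis
    unfolding partition_pmf_def using nn by (subst pmf_embed_pmf) (simp_all del: if_split)
qed

end

theory Submission
  imports Defs
begin

text \<open>
  Given the partition \<open>l\<close>, the law of the output is invariant under permuting the coordinates and
  under negating any set of coordinates. These maps act transitively on the vectors with
  decomposition \<open>l\<close>, so this law is uniform on \<open>decomp_vecs n m l\<close>; the choice of \<open>partition_prob\<close>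
  then gives every vector of the sphere the same total mass. By symmetry it also does not matter
  that two sign vectors may yield the same output (for parts equal to \<open>m / 2\<close>).
\<close>

text \<open>Keeps the simplifier from turning \<open>{1..n}\<close> into \<open>{Suc 0..n}\<close>,
  which would no longer match facts stated with \<open>{1..n}\<close>.\<close>

declare One_nat_def [simp del]

section \<open>Uniformity from symmetry\<close>

text \<open>Swapping \<open>x\<close> and \<open>y\<close> turns the inequality into equality, and
  total mass one fixes the common value.\<close>

lemma pmf_eq_pmf_of_setI:
  assumes "finite A" "set_pmf M \<subseteq> A" "\<And>x y. x \<in> A \<Longrightarrow> y \<in> A \<Longrightarrow> pmf M x \<le> pmf M y"
  shows "M = pmf_of_set A"
proof -
  obtain a where a: "a \<in> set_pmf M"
    using set_pmf_not_empty by fast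
  have const: "pmf M x = pmf M a" if "x \<in> A" for x
    using that a assms(2,3) by (meson order_antisym subsetD)
  have "(\<Sum>x\<in>A. pmf M x) = 1"
    by (rule sum_pmf_eq_1) (use assms in auto)
  then have "real (card A) * pmf M a = 1"
    using const by simp
  then have "pmf M a = 1 / real (card A)"
    by (metis div_by_1 divide_divide_eq_right mult.commute mult_zero_left nonzero_eq_divide_eq
        zero_neq_one)
  moreover have "A \<noteq> {}"
    using a assms(2) by auto
  ultimately show ?thesis
    using assms(1,2) const
    by (intro pmf_eqI) (auto simp: indicator_def set_pmf_iff)
qed

text \<open>The fibre of \<open>h\<close> over \<open>h x\<close> contains \<open>x\<close>. An
  inequality suits maps such as \<open>negate_on\<close>, which reduces mod \<open>m\<close> and so
  need not be injective on all integer-valued functions.\<close>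

lemma pmf_le_pmf_map:
  assumes "map_pmf h M = M"
  shows "pmf M x \<le> pmf M (h x)"
proof -
  have "pmf M x = measure M {x}"
    by (simp add: pmf.rep_eq)
  also have "\<dots> \<le> measure M (h -` {h x})"
    by (rule measure_pmf.finite_measure_mono) auto
  also have "\<dots> = pmf (map_pmf h M) (h x)"
    by (simp add: pmf_map)
  finally show ?thesis
    using assms by simp
qed

section \<open>Lee weights and weight decompositions\<close>

lemma lee_wt_eq_imp:
  assumes "a \<in> {0..int m - 1}" "b \<in> {0..int m - 1}" "lee_wt m a = lee_wt m b" "a \<noteq> b"
  shows "b = (- a) mod int m"
proof -
  \<comment> \<open>If \<open>a = 0\<close>, the common weight is 0, which forces
    \<open>b = 0\<close> because \<open>b < m\<close>. For nonzero \<open>a\<close>, the residue of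
    \<open>- a\<close> is \<open>m - a\<close>.\<close>
  have "b = int m - a" "a \<noteq> 0"
    using assms by (auto simp: lee_wt_def min_def split: if_splits)
  then show ?thesis
    using assms by (auto simp: zmod_zminus1_eq_if)
qed

text \<open>The two residues are \<open>k\<close> and \<open>m - k\<close>; by
  \<open>2 * k \<le> m\<close> the smaller of these numbers is \<open>k\<close> for either
  sign.\<close>

lemma lee_wt_mod:
  assumes "0 < k" "k \<le> m div 2" "s = 1 \<or> s = -1"
  shows "lee_wt m ((s * int k) mod int m) = k" "(s * int k) mod int m \<noteq> 0"
proof -
  have k: "int k mod int m = int k" "2 * k \<le> m" "\<not> int m dvd int k"
    using assms by (auto dest: dvd_imp_le)
  show "lee_wt m ((s * int k) mod int m) = k" "(s * int k) mod int m \<noteq> 0"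
    using assms(1,3) k by (auto simp: lee_wt_def zmod_zminus1_eq_if)
qed

lemma zm_vecs_range: "x \<in> zm_vecs n m \<Longrightarrow> i \<in> {1..n} \<Longrightarrow> x i \<in> {0..int m - 1}"
  by (auto simp: zm_vecs_def residue_ring_def PiE_iff)

text \<open>\<open>p\<close> maps the support of \<open>x \<circ> p\<close> bijectively onto the
  support of \<open>x\<close>.\<close>

lemma weight_decomp_comp:
  assumes "p permutes {1..n}"
  shows "weight_decomp n m (x \<circ> p) = weight_decomp n m x"
proof -
  have "p ` {i\<in>{1..n}. x (p i) \<noteq> 0} = {i\<in>p ` {1..n}. x i \<noteq> 0}"
    by blast
  then have "p ` {i\<in>{1..n}. x (p i) \<noteq> 0} = {i\<in>{1..n}. x i \<noteq> 0}"
    by (simp only: permutes_image[OF assms])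
  moreover have "inj_on p {i\<in>{1..n}. x (p i) \<noteq> 0}"
    using permutes_inj[OF assms] by (rule inj_on_subset) simp
  ultimately have "mset_set {i\<in>{1..n}. x i \<noteq> 0} = image_mset p (mset_set {i\<in>{1..n}. x (p i) \<noteq> 0})"
    by (simp add: image_mset_mset_set)
  then show ?thesis
    by (simp add: weight_decomp_def multiset.map_comp o_def)
qed

lemma size_weight_decomp: "size (weight_decomp n m x) = card {i\<in>{1..n}. x i \<noteq> 0}"
  by (simp add: weight_decomp_def)

lemma size_weight_decomp_le: "size (weight_decomp n m x) \<le> n"
proof -
  have "card {i\<in>{1..n}. x i \<noteq> 0} \<le> card {1..n}"
    by (rule card_mono) auto
  then show ?thesis
    by (simp add: size_weight_decomp)
qed

text \<open>Padding with a zero for each zero coordinate gives a multiset indexed by all of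
  \<open>{1..n}\<close>. Vectors with equal decompositions can then be matched by a permutation of
  all coordinates.\<close>

lemma image_lee_wt_weight_decomp:
  "image_mset (\<lambda>i. lee_wt m (x i)) (mset_set {1..n}) =
    weight_decomp n m x + replicate_mset (n - size (weight_decomp n m x)) 0"
proof -
  let ?A = "{i\<in>{1..n}. x i \<noteq> 0}" and ?B = "{i\<in>{1..n}. x i = 0}"
  have U: "{1..n} = ?A \<union> ?B" by auto
  have "mset_set {1..n} = mset_set ?A + mset_set ?B"
    by (subst U, rule mset_set_Union) auto
  moreover have "image_mset (\<lambda>i. lee_wt m (x i)) (mset_set ?B) = image_mset (\<lambda>i. 0) (mset_set ?B)"
    by (rule image_mset_cong) (auto simp: lee_wt_def)
  moreover have "card ?B = n - card ?A"
  proof -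
    have "card {1..n} = card ?A + card ?B"
      by (subst U, rule card_Un_disjoint) auto
    then show ?thesis by simp
  qed
  ultimately show ?thesis
    unfolding size_weight_decomp by (simp add: weight_decomp_def image_mset_const_eq)
qed

lemma lee_weight_eq_sum_weight_decomp: "lee_weight n m x = sum_mset (weight_decomp n m x)"
proof -
  have "lee_weight n m x = sum_mset (image_mset (\<lambda>i. lee_wt m (x i)) (mset_set {1..n}))"
    by (simp add: lee_weight_def sum_unfold_sum_mset)
  then show ?thesis
    by (simp add: image_lee_wt_weight_decomp)
qed

text \<open>Together with \<open>lee_sphere_decomp\<close> and \<open>decomp_vecs_unique\<close>,
  this splits the sphere into the disjoint sets \<open>decomp_vecs n m l\<close>.\<close>

lemma decomp_vecs_subset_lee_sphere:
  assumes "l \<in> partitions r t"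
  shows "decomp_vecs n m l \<subseteq> lee_sphere n m t"
  using assms
  by (auto simp: decomp_vecs_def lee_sphere_def lee_weight_eq_sum_weight_decomp partitions_def
      sum_mset_sum_list)

text \<open>A weakly decreasing list is determined by its multiset; reversal brings it into the
  increasing order of \<open>sorted\<close>.\<close>

lemma decomp_vecs_unique:
  assumes "l \<in> partitions r t" "l' \<in> partitions r t"
    and "x \<in> decomp_vecs n m l" "x \<in> decomp_vecs n m l'"
  shows "l = l'"
proof -
  have "mset (rev l) = mset (rev l')"
    using assms by (simp add: decomp_vecs_def)
  moreover have "sorted (rev l)" "sorted (rev l')"
    using assms by (auto simp: partitions_def sorted_wrt_rev)
  ultimately have "rev l = rev l'"
    by (metis properties_for_sort)
  then show ?thesis by simp
qed

definition negate_on :: "nat \<Rightarrow> nat set \<Rightarrow> (nat \<Rightarrow> int) \<Rightarrow> nat \<Rightarrow> int" where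
  "negate_on m J x = (\<lambda>i. if i \<in> J then (- x i) mod int m else x i)"

text \<open>A permutation first makes the Lee weights agree coordinatewise; what then remains is a
  choice between a residue and its negative in each coordinate.\<close>

lemma decomp_vecs_transitive:
  assumes "x \<in> decomp_vecs n m l" "y \<in> decomp_vecs n m l"
  obtains q J where "q permutes {1..n}" "J \<subseteq> {1..n}" "y = negate_on m J (x \<circ> q)"
proof -
  have "image_mset (\<lambda>i. lee_wt m (y i)) (mset_set {1..n}) =
      image_mset (\<lambda>i. lee_wt m (x i)) (mset_set {1..n})"
    using assms by (simp add: image_lee_wt_weight_decomp decomp_vecs_def)
  then obtain q where q: "q permutes {1..n}"
    and wt: "\<And>i. i \<in> {1..n} \<Longrightarrow> lee_wt m (y i) = lee_wt m (x (q i))"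
    by (rule image_mset_eq_implies_permutes[rotated]) auto
  have xy: "x \<in> zm_vecs n m" "y \<in> zm_vecs n m"
    using assms by (auto simp: decomp_vecs_def)
  \<comment> \<open>The coordinates that still differ: there equal Lee weights leave only the
    negated residue.\<close>
  define J where "J = {i\<in>{1..n}. x (q i) \<noteq> y i}"
  have "y i = negate_on m J (x \<circ> q) i" for i
  proof (cases "i \<in> {1..n}")
    case True
    then have "q i \<in> {1..n}"
      using permutes_in_image[OF q] by blast
    then have "x (q i) \<noteq> y i \<Longrightarrow> y i = (- x (q i)) mod int m"
      using lee_wt_eq_imp zm_vecs_range[OF xy(1)] zm_vecs_range[OF xy(2) True] wt[OF True]
      by metis
    then show ?thesis
      using True by (simp add: negate_on_def J_def)
  next
    case False
    then have "i \<notin> J"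
      unfolding J_def by blast
    moreover have "x i = undefined" "y i = undefined"
      using False xy[unfolded zm_vecs_def] by (blast intro: PiE_arb)+
    ultimately show ?thesis
      using permutes_not_in[OF q False] by (simp add: negate_on_def)
  qed
  then have "y = negate_on m J (x \<circ> q)"
    by (rule ext)
  moreover have "J \<subseteq> {1..n}"
    unfolding J_def by blast
  ultimately show ?thesis
    using that q by blast
qed

section \<open>Placing signed parts on a fixed support\<close>

context
  fixes n m :: nat and l :: "nat list" and S :: "nat set"
  assumes S: "S \<subseteq> {1..n}" "card S = length l"
begin

lemma finite_S: "finite S"
  using S finite_subset by blast

text \<open>The positions in \<open>sorted_list_of_set S\<close> are distinct, so the lookup finds
  the \<open>j\<close>-th pair. With \<open>place_notin\<close> and \<open>place_outside\<close>
  this describes \<open>place\<close> completely.\<close>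

lemma place_nth:
  assumes "length f = length l" "j < length l"
  shows "place n m l f S (sorted_list_of_set S ! j) = (f ! j * int (l ! j)) mod int m"
proof -
  let ?ss = "sorted_list_of_set S"
  have len: "length ?ss = length l"
    using S by simp
  have "?ss ! j \<in> S"
    using len assms nth_mem[of j ?ss] finite_S by simp
  then have "?ss ! j \<in> {1..n}"
    using S by blast
  moreover have "map_of (zip ?ss (map2 (\<lambda>s k. (s * int k) mod int m) f l)) (?ss ! j) =
      Some (map2 (\<lambda>s k. (s * int k) mod int m) f l ! j)"
    by (rule map_of_zip_nth) (use assms len in auto)
  ultimately show ?thesis
    using assms by (simp add: place_def)
qed

lemma place_notin:
  assumes "i \<notin> S" "i \<in> {1..n}"
  shows "place n m l f S i = 0"
proof -
  have "map_of (zip (sorted_list_of_set S) (map2 (\<lambda>s k. (s * int k) mod int m) f l)) i = None"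
    using assms finite_S by (auto simp: map_of_eq_None_iff dest!: set_zip_leftD)
  then show ?thesis
    using assms by (simp add: place_def)
qed

lemma place_outside: "i \<notin> {1..n} \<Longrightarrow> place n m l f S i = undefined"
  by (simp only: place_def restrict_apply if_False)

lemma obtain_nth:
  assumes "i \<in> S"
  obtains j where "j < length l" "i = sorted_list_of_set S ! j"
  using assms finite_S S by (metis in_set_conv_nth length_sorted_list_of_set set_sorted_list_of_set)

text \<open>The counterpart of \<open>negate_on\<close> on sign lists: a sign is addressed by the
  element of \<open>S\<close> at which its part is placed.\<close>

definition flip_signs :: "nat set \<Rightarrow> int list \<Rightarrow> int list" where
  "flip_signs K f = map2 (\<lambda>i s. if i \<in> K then - s else s) (sorted_list_of_set S) f"

lemma length_flip_signs: "length f = length l \<Longrightarrow> length (flip_signs K f) = length l"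
  using S by (simp add: flip_signs_def)

lemma flip_signs_nth:
  assumes "length f = length l" "j < length l"
  shows "flip_signs K f ! j = (if sorted_list_of_set S ! j \<in> K then - (f ! j) else f ! j)"
  using S assms by (simp add: flip_signs_def)

text \<open>On \<open>S\<close>, negation commutes with reduction mod \<open>m\<close>; elsewhere in
  \<open>{1..n}\<close> the entry is 0, its own negative, so \<open>K\<close> may reach beyond
  \<open>S\<close>.\<close>

lemma negate_on_place:
  assumes "length f = length l" "K \<subseteq> {1..n}"
  shows "negate_on m K (place n m l f S) = place n m l (flip_signs K f) S"
proof
  fix i
  consider "i \<in> S" | "i \<notin> S" "i \<in> {1..n}" | "i \<notin> {1..n}"
    by blast
  then show "negate_on m K (place n m l f S) i = place n m l (flip_signs K f) S i"
  proof cases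
    case 1
    then obtain j where "j < length l" "i = sorted_list_of_set S ! j"
      using obtain_nth by blast
    then show ?thesis
      using assms
      by (simp add: negate_on_def place_nth flip_signs_nth length_flip_signs mod_minus_eq)
  next
    case 2
    then show ?thesis
      by (simp add: negate_on_def place_notin)
  next
    case 3
    then show ?thesis
      using assms by (auto simp: negate_on_def place_outside)
  qed
qed

text \<open>\<open>flip_signs K\<close> is an involution of the finite set \<open>F\<close>, hence a
  bijection that preserves the uniform law.\<close>

lemma map_flip_signs:
  defines "F \<equiv> {f. length f = length l \<and> set f \<subseteq> {1, -1}}"
  shows "map_pmf (flip_signs K) (pmf_of_set F) = pmf_of_set F"
proof -
  have "finite {f. set f \<subseteq> {1, -1::int} \<and> length f = length l}"
    by (rule finite_lists_length_eq) simp
  then have fin: "finite F"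
    by (simp add: F_def conj_commute)
  have "replicate (length l) 1 \<in> F"
    by (auto simp: F_def)
  then have ne: "F \<noteq> {}" by blast
  have invol: "flip_signs K (flip_signs K f) = f" if "f \<in> F" for f
  proof -
    have len: "length f = length l"
      using that by (simp add: F_def)
    show ?thesis
      by (rule nth_equalityI) (simp_all add: len length_flip_signs flip_signs_nth)
  qed
  have closed: "flip_signs K f \<in> F" if "f \<in> F" for f
  proof -
    have len: "length f = length l"
      using that by (simp add: F_def)
    have "flip_signs K f ! j \<in> {1, -1}" if "j < length (flip_signs K f)" for j
    proof -
      have "set f \<subseteq> {1, -1}"
        using \<open>f \<in> F\<close> by (simp add: F_def)
      moreover have j: "j < length l"
        using that by (simp add: length_flip_signs len)
      then have "f ! j \<in> set f"
        using len by simp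
      ultimately have "f ! j = 1 \<or> f ! j = -1"
        by blast
      then show ?thesis
        using j len by (auto simp: flip_signs_nth)
    qed
    then have "set (flip_signs K f) \<subseteq> {1, -1}"
      unfolding set_conv_nth by blast
    then show ?thesis
      by (simp add: F_def length_flip_signs len)
  qed
  have "bij_betw (flip_signs K) F F"
    by (rule bij_betwI[where g = "flip_signs K"]) (use closed invol in auto)
  then have "flip_signs K ` F = F" "inj_on (flip_signs K) F"
    by (simp_all add: bij_betw_def)
  then show ?thesis
    by (simp add: map_pmf_of_set_inj fin ne)
qed

text \<open>Signed parts are nonzero mod \<open>m\<close>, so the support is exactly
  \<open>S\<close>, and reading the Lee weights along the sorted support gives back
  \<open>l\<close>.\<close>

lemma place_in_decomp_vecs:
  assumes "0 < m" "l \<in> partitions (m div 2) t" "length f = length l" "set f \<subseteq> {1, -1}"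
  shows "place n m l f S \<in> decomp_vecs n m l"
proof -
  let ?ss = "sorted_list_of_set S" and ?x = "place n m l f S"
  have len: "length ?ss = length l"
    using S by simp
  have entry: "lee_wt m (?x (?ss ! j)) = l ! j" "?x (?ss ! j) \<noteq> 0"
      "?x (?ss ! j) \<in> {0..int m - 1}" if "j < length l" for j
  proof -
    have k: "0 < l ! j" "l ! j \<le> m div 2"
      using assms(2) that by (auto simp: partitions_def)
    moreover have "f ! j \<in> set f"
      using assms(3) that by simp
    then have "f ! j = 1 \<or> f ! j = -1"
      using assms(4) by blast
    ultimately show "lee_wt m (?x (?ss ! j)) = l ! j" "?x (?ss ! j) \<noteq> 0"
      using lee_wt_mod[of "l ! j" m "f ! j"] that assms(3) by (auto simp: place_nth)
    show "?x (?ss ! j) \<in> {0..int m - 1}"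
      using k that assms(3) by (simp add: place_nth)
  qed
  have supp: "{i\<in>{1..n}. ?x i \<noteq> 0} = S"
  proof (intro equalityI subsetI)
    fix i assume "i \<in> S"
    then obtain j where "j < length l" "i = ?ss ! j"
      by (rule obtain_nth)
    then show "i \<in> {i\<in>{1..n}. ?x i \<noteq> 0}"
      using entry(2) S \<open>i \<in> S\<close> by blast
  qed (use place_notin in blast)
  have "weight_decomp n m ?x = mset (map (\<lambda>i. lee_wt m (?x i)) ?ss)"
    unfolding weight_decomp_def supp using finite_S mset_set_set[of ?ss] by simp
  also have "map (\<lambda>i. lee_wt m (?x i)) ?ss = l"
    by (rule nth_equalityI) (simp_all add: S(2) entry(1))
  finally have "weight_decomp n m ?x = mset l" .
  moreover have "?x i \<in> {0..int m - 1}" if "i \<in> {1..n}" for i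
  proof (cases "i \<in> S")
    case True
    then obtain j where "j < length l" "i = ?ss ! j"
      by (rule obtain_nth)
    then show ?thesis
      using entry(3) by simp
  next
    case False
    then show ?thesis
      \<comment> \<open>\<open>0 < m\<close> makes 0 an element of
        \<open>{0..int m - 1}\<close>.\<close>
      using that assms(1) by (simp add: place_notin)
  qed
  then have "?x \<in> zm_vecs n m"
    unfolding zm_vecs_def residue_ring_def by (intro PiE_I) (simp_all add: place_outside)
  ultimately show ?thesis
    by (simp add: decomp_vecs_def)
qed

end

section \<open>Invariance and uniformity for a fixed partition\<close>

text \<open>Right translation by a group element is a bijection of the finite group of permutations
  of \<open>A\<close>.\<close>

lemma map_comp_permutation:
  assumes "q permutes A" "finite A"
  shows "map_pmf (\<lambda>p. p \<circ> q) (pmf_of_set {p. p permutes A}) = pmf_of_set {p. p permutes A}"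
proof -
  have "(\<lambda>p. p \<circ> q) ` {p. p permutes A} = {p. p permutes A}"
    using assms image_compose_permutations_right by blast
  moreover have "inj_on (\<lambda>p. p \<circ> q) {p. p permutes A}"
    using permutes_inv_o(1)[OF assms(1)] by (intro inj_onI) (metis comp_assoc comp_id)
  moreover have "finite {p. p permutes A}" "{p. p permutes A} \<noteq> {}"
    using assms finite_permutations by auto
  ultimately show ?thesis
    using map_pmf_of_set_inj[of "\<lambda>p. p \<circ> q" "{p. p permutes A}"] by simp
qed

definition place_pmf :: "nat \<Rightarrow> nat \<Rightarrow> nat list \<Rightarrow> (nat \<Rightarrow> int) pmf" where
  "place_pmf n m l = do {
     f \<leftarrow> pmf_of_set {f. length f = length l \<and> set f \<subseteq> {1, -1}};
     S \<leftarrow> pmf_of_set {S. S \<subseteq> {1..n} \<and> card S = length l};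
     p \<leftarrow> pmf_of_set {p. p permutes {1..n}};
     return_pmf (place n m l f S \<circ> p)
   }"

lemma lee_sampler_eq: "lee_sampler n m t = partition_pmf n m t \<bind> place_pmf n m"
  unfolding lee_sampler_def place_pmf_def[abs_def] ..

text \<open>The final uniform permutation absorbs \<open>q\<close>, since
  \<open>(x \<circ> p) \<circ> q = x \<circ> (p \<circ> q)\<close>. This already holds for each
  fixed placed vector \<open>x\<close>.\<close>

lemma map_permutation_place_pmf:
  assumes "q permutes {1..n}"
  shows "map_pmf (\<lambda>x. x \<circ> q) (place_pmf n m l) = place_pmf n m l"
proof -
  let ?P = "pmf_of_set {p. p permutes {1..n}}"
  have "map_pmf (\<lambda>y. y \<circ> q) (map_pmf (\<lambda>p. x \<circ> p) ?P) = map_pmf (\<lambda>p. x \<circ> p) ?P"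
    for x :: "nat \<Rightarrow> int"
  proof -
    have "map_pmf (\<lambda>y. y \<circ> q) (map_pmf (\<lambda>p. x \<circ> p) ?P) = map_pmf (\<lambda>p. x \<circ> p) (map_pmf (\<lambda>p. p \<circ> q) ?P)"
      by (simp add: pmf.map_comp o_def)
    then show ?thesis
      using assms by (simp only: map_comp_permutation finite_atLeastAtMost)
  qed
  then show ?thesis
    unfolding place_pmf_def map_bind_pmf map_pmf_def[symmetric] by simp
qed

context
  fixes n m :: nat and l :: "nat list"
  assumes length_l: "length l \<le> n"
begin

text \<open>The bound \<open>length l \<le> n\<close> supplies a subset of the required size; on an
  empty set \<open>pmf_of_set\<close> would be unspecified.\<close>

lemma set_pmf_of_subsets:
  "set_pmf (pmf_of_set {S. S \<subseteq> {1..n} \<and> card S = length l}) =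
    {S. S \<subseteq> {1..n} \<and> card S = length l}"
proof (rule set_pmf_of_set)
  have "{1..length l} \<in> {S. S \<subseteq> {1..n} \<and> card S = length l}"
    using length_l by simp
  then show "{S. S \<subseteq> {1..n} \<and> card S = length l} \<noteq> {}"
    by blast
qed simp

lemma set_pmf_of_permutations:
  "set_pmf (pmf_of_set {p. p permutes {1..n}}) = {p. p permutes {1..n}}"
proof (rule set_pmf_of_set)
  show "{p. p permutes {1..n}} \<noteq> {}"
    using permutes_id by blast
qed (simp add: finite_permutations)

lemma set_pmf_of_signs:
  "set_pmf (pmf_of_set {f. length f = length l \<and> set f \<subseteq> {1, -1}}) =
    {f :: int list. length f = length l \<and> set f \<subseteq> {1, -1}}"
proof (rule set_pmf_of_set)
  have "replicate (length l) 1 \<in> {f :: int list. length f = length l \<and> set f \<subseteq> {1, -1}}"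
    by auto
  then show "{f :: int list. length f = length l \<and> set f \<subseteq> {1, -1}} \<noteq> {}"
    by blast
  have "finite {f. set f \<subseteq> {1, -1::int} \<and> length f = length l}"
    by (rule finite_lists_length_eq) simp
  then show "finite {f :: int list. length f = length l \<and> set f \<subseteq> {1, -1}}"
    by (simp add: conj_commute)
qed

text \<open>For fixed \<open>S\<close> and \<open>p\<close>, negating output coordinates amounts to
  flipping signs in \<open>f\<close>, and the uniform law of \<open>f\<close> is unchanged by
  this.\<close>

lemma map_negate_on_place_pmf:
  assumes "J \<subseteq> {1..n}"
  shows "map_pmf (negate_on m J) (place_pmf n m l) = place_pmf n m l"
proof -
  let ?F = "pmf_of_set {f :: int list. length f = length l \<and> set f \<subseteq> {1, -1}}"
  let ?S = "pmf_of_set {S. S \<subseteq> {1..n} \<and> card S = length l}"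
  let ?P = "pmf_of_set {p. p permutes {1..n}}"
  \<comment> \<open>The independent choices are reordered so that the signs are drawn last, with
    \<open>S\<close> and \<open>p\<close> already fixed.\<close>
  have eq: "place_pmf n m l = ?S \<bind> (\<lambda>S. ?P \<bind> (\<lambda>p. map_pmf (\<lambda>f. place n m l f S \<circ> p) ?F))"
    unfolding place_pmf_def map_pmf_def
    by (subst bind_commute_pmf, rule bind_pmf_cong[OF refl], rule bind_commute_pmf)
  have "map_pmf (negate_on m J) (map_pmf (\<lambda>f. place n m l f S \<circ> p) ?F) =
      map_pmf (\<lambda>f. place n m l f S \<circ> p) ?F"
    if S: "S \<subseteq> {1..n}" "card S = length l" and p: "p permutes {1..n}" for S p
  proof -
    have K: "p ` J \<subseteq> {1..n}"
      using permutes_image[OF p] assms by blast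
    have "negate_on m J (place n m l f S \<circ> p) = place n m l (flip_signs S (p ` J) f) S \<circ> p"
      if "length f = length l" for f
    proof -
      \<comment> \<open>Coordinate \<open>i\<close> of the output is read at \<open>p i\<close>; by
        injectivity, \<open>i\<close> lies in \<open>J\<close> iff \<open>p i\<close> lies in the
        image of \<open>J\<close>.\<close>
      have "negate_on m J (place n m l f S \<circ> p) = negate_on m (p ` J) (place n m l f S) \<circ> p"
        using permutes_inj[OF p] by (auto simp: negate_on_def fun_eq_iff inj_image_mem_iff)
      then show ?thesis
        using negate_on_place[OF S that K] by simp
    qed
    then have "map_pmf (\<lambda>f. negate_on m J (place n m l f S \<circ> p)) ?F =
        map_pmf (\<lambda>f. place n m l (flip_signs S (p ` J) f) S \<circ> p) ?F"
      by (intro map_pmf_cong refl) (simp add: set_pmf_of_signs)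
    also have "\<dots> = map_pmf (\<lambda>f. place n m l f S \<circ> p) (map_pmf (flip_signs S (p ` J)) ?F)"
      by (simp add: pmf.map_comp o_def)
    finally show ?thesis
      using map_flip_signs[OF S] by (simp add: pmf.map_comp o_def)
  qed
  then show ?thesis
    unfolding eq map_bind_pmf
    by (intro bind_pmf_cong refl) (simp_all add: set_pmf_of_subsets set_pmf_of_permutations)
qed

lemma set_place_pmf:
  assumes "0 < m" "l \<in> partitions (m div 2) t"
  shows "set_pmf (place_pmf n m l) \<subseteq> decomp_vecs n m l"
proof
  fix x assume "x \<in> set_pmf (place_pmf n m l)"
  then obtain f S p where fSp: "length f = length l" "set f \<subseteq> {1, -1}" "S \<subseteq> {1..n}"
      "card S = length l" and p: "p permutes {1..n}" and x: "x = place n m l f S \<circ> p"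
    by (auto simp: place_pmf_def set_pmf_of_subsets set_pmf_of_permutations set_pmf_of_signs)
  have "place n m l f S \<in> decomp_vecs n m l"
    using place_in_decomp_vecs assms fSp by blast
  moreover have "x \<in> zm_vecs n m" if "place n m l f S \<in> zm_vecs n m"
    using that permutes_in_image[OF p] permutes_not_in[OF p]
    unfolding zm_vecs_def x PiE_iff extensional_def by auto
  ultimately show "x \<in> decomp_vecs n m l"
    unfolding decomp_vecs_def using weight_decomp_comp[OF p] x by simp
qed

lemma place_pmf_uniform:
  assumes "0 < m" "l \<in> partitions (m div 2) t"
  shows "place_pmf n m l = pmf_of_set (decomp_vecs n m l)"
proof (rule pmf_eq_pmf_of_setI)
  show "finite (decomp_vecs n m l)"
    using finite_zm_vecs by (simp add: decomp_vecs_def)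
  show "set_pmf (place_pmf n m l) \<subseteq> decomp_vecs n m l"
    using set_place_pmf assms by blast
  fix x y assume "x \<in> decomp_vecs n m l" "y \<in> decomp_vecs n m l"
  then obtain q J where q: "q permutes {1..n}" and J: "J \<subseteq> {1..n}"
    and y: "y = negate_on m J (x \<circ> q)"
    by (rule decomp_vecs_transitive)
  have "pmf (place_pmf n m l) x \<le> pmf (place_pmf n m l) (x \<circ> q)"
    using pmf_le_pmf_map[OF map_permutation_place_pmf[OF q]] .
  also have "\<dots> \<le> pmf (place_pmf n m l) y"
    unfolding y using pmf_le_pmf_map[OF map_negate_on_place_pmf[OF J]] .
  finally show "pmf (place_pmf n m l) x \<le> pmf (place_pmf n m l) y" .
qed

end

section \<open>Mixing the uniform laws over all partitions\<close>

theorem theorem2: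
  fixes n m t :: nat
  assumes "0 < n" and "0 < m" and "0 < t"
    and "lee_sphere n m t \<noteq> {}"
  shows "lee_sampler n m t = pmf_of_set (lee_sphere n m t)"
proof -
  let ?P = "partitions (m div 2) t"
  let ?V = "decomp_vecs n m"
  let ?d = "\<Sum>l\<in>?P. real (card (?V l))"
  have finV: "finite (?V l)" for l
    using finite_zm_vecs by (simp add: decomp_vecs_def)
  note pmf_l = pmf_partition_pmf[OF assms(4)]
  have uniform: "place_pmf n m l = pmf_of_set (?V l)" if l: "l \<in> ?P" and V: "?V l \<noteq> {}" for l
  proof -
    obtain x where "weight_decomp n m x = mset l"
      using V by (auto simp: decomp_vecs_def)
    \<comment> \<open>The number of parts equals the number of nonzero coordinates of
      \<open>x\<close>.\<close>
    then have "length l \<le> n"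
      using size_weight_decomp_le[of n m x] by simp
    then show ?thesis
      using place_pmf_uniform assms(2) l by blast
  qed
  \<comment> \<open>The numerator of \<open>partition_prob\<close> cancels against the uniform mass
    on \<open>?V l\<close>, leaving a constant independent of \<open>l\<close>.\<close>
  have summand: "pmf (place_pmf n m l) x * pmf (partition_pmf n m t) l =
      (if x \<in> ?V l then 1 / ?d else 0)" if "l \<in> ?P" for l x
  proof (cases "?V l = {}")
    \<comment> \<open>Here \<open>place_pmf\<close> may be unspecified, but its weight in the
      mixture is zero.\<close>
    case True
    then show ?thesis
      by (simp add: pmf_l partition_prob_def)
  next
    case False
    then show ?thesis
      using that finV[of l] by (simp add: pmf_l uniform partition_prob_def indicator_def)
  qed
  have pmf_x: "pmf (lee_sampler n m t) x = (\<Sum>l\<in>?P. if x \<in> ?V l then 1 / ?d else 0)" for x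
  proof -
    have "pmf (lee_sampler n m t) x =
        (\<Sum>l\<in>?P. pmf (place_pmf n m l) x * pmf (partition_pmf n m t) l)"
      unfolding lee_sampler_eq pmf_bind
      by (rule integral_measure_pmf_real[OF finite_partitions])
        (simp add: set_pmf_iff pmf_l split: if_splits)
    then show ?thesis
      using summand by simp
  qed
  have in_sphere: "pmf (lee_sampler n m t) x = 1 / ?d" if "x \<in> lee_sphere n m t" for x
  proof -
    obtain l where l: "l \<in> ?P" "x \<in> ?V l"
      using lee_sphere_decomp \<open>x \<in> lee_sphere n m t\<close> by blast
    \<comment> \<open>Exactly one partition contributes, the one given by the decomposition of
      \<open>x\<close>.\<close>
    have "pmf (lee_sampler n m t) x = (\<Sum>l'\<in>?P. if l' = l then 1 / ?d else 0)"
      unfolding pmf_x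
    proof (rule sum.cong[OF refl])
      fix l' assume l': "l' \<in> ?P"
      have "x \<in> ?V l' \<longleftrightarrow> l' = l"
        using decomp_vecs_unique[OF l' l(1) _ l(2)] l(2) by blast
      then show "(if x \<in> ?V l' then 1 / ?d else 0) = (if l' = l then 1 / ?d else 0)"
        by (simp only:)
    qed
    then show ?thesis
      using l finite_partitions by simp
  qed
  show ?thesis
  \<comment> \<open>Equal masses on the sphere suffice: normalization identifies the constant
    \<open>1 / ?d\<close> with the reciprocal of its cardinality.\<close>
  proof (rule pmf_eq_pmf_of_setI)
    show "finite (lee_sphere n m t)"
      using finite_zm_vecs by (simp add: lee_sphere_def)
    have "pmf (lee_sampler n m t) x = 0" if "x \<notin> lee_sphere n m t" for x
      unfolding pmf_x
    proof (intro sum.neutral ballI)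
      fix l assume "l \<in> ?P"
      then have "x \<notin> ?V l"
        using that decomp_vecs_subset_lee_sphere by blast
      then show "(if x \<in> ?V l then 1 / ?d else 0) = 0"
        by (rule if_not_P)
    qed
    then show "set_pmf (lee_sampler n m t) \<subseteq> lee_sphere n m t"
      unfolding set_pmf_eq by blast
  qed (simp add: in_sphere)
qed

end
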